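(* Let $\{Q_t\}_{t\ge0}$ be a continuous-time semiflow on $C_+$ such that each $Q_t$ satisfies (A1) and (A2). Suppose that for some $t_0>0$ the map $Q:=Q_{t_0}$ satisfies (A3) and (A4), with associated limit maps $Q_\pm$ and $r^*\in\mathrm{Int}(Y_+)$, and that: $Q_-$ satisfies (UAA); $Q_+$ satisfies (UC) with constants $c_\pm^*$; either $Q$ is subhomogeneous on $[0,r^*]_C$ and satisfies (SP), or $Q$ satisfies (ASH-UC-SP) (in which case $c_\pm^*=\lim_{l\to\infty}c_{\pm l}^*$); $\{Q^n[r^*]:n\in\mathbb N\}$ is precompact in $C$; and, in case $c_+^*\le0$, $\{(T_{x_0}\circ Q)^n[r^*]:n\in\mathbb N\}$ is precompact in $C$ for some $x_0\in(-c_+^*,c_-^* )$. If $c_-^*>0$ and $Q_t[r^*]\le r^*$ for all $t\in\mathbb R_+$, then $\{Q_t\}_{t\in\mathbb R_+}$ has an equilibrium point $W$ connecting $0$ to $r^*$.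
   Context: Spaces. Fix $N\ge1$ and a compact topological space $M$. $X$ is the space of bounded continuous functions $\mathbb R\to\mathbb R^N$ with norm $\|\phi\|_X=\sum_{n\ge1}2^{-n}\sup_{|x|\le n}\|\phi(x)\|_{\mathbb R^N}$. $C=C(M,X)$ with norm $\sup_{\theta\in M}\|\varphi(\theta)\|_X$; elements of $C$ are identified with bounded continuous functions $\varphi(\theta,x)$ from $M\times\mathbb R$ to $\mathbb R^N$. $C_+=\{\varphi\in C:\varphi(\theta,x)\in\mathbb R_+^N\ \forall(\theta,x)\}$. $Y=C(M,\mathbb R^N)$ with sup norm, $Y_+=C(M,\mathbb R^N_+)$, $\mathrm{Int}(Y_+)=\{\beta\in Y:\beta(\theta)\in \mathrm{Int}(\mathbb R^N_+)\ \forall\theta\}$. Vectors of $\mathbb R^N$ and elements of $Y$ are identified with the elements of $C$ that are constant in the remaining variables. Order relations $\le$ and suprema of $\mathbb R^N$-valued quantities are pointwise and componentwise. For $\psi\in C_+$, $C_\psi=[0,\psi]_C=\{\varphi\in C:0\le\varphi\le\psi\}$. $T_y[\varphi](\theta,x)=\varphi(\theta,x-y)$ for $y\in\mathbb R$. Continuous-time semiflow on $C_+$: a map $Q:\mathbb R_+\times C_+\to C_+$, $Q_t=Q(t,\cdot)$, such that for every vector $r\in\mathrm{Int}(\mathbb R^N_+)$ the restriction to $\mathbb R_+\times C_r$ is continuous, $Q_0=\mathrm{Id}$, and $Q_t\circ Q_s=Q_{t+s}$ for all $t,s\ge0$. An equilibrium point is a bounded continuous $W:M\times\mathbb R\to\mathbb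 R_+^N$ with $Q_t[W]=W$ for all $t\in\mathbb R_+$; it connects $0$ to $r^*$ if $W(\cdot,-\infty):=\lim_{s\to-\infty}W(\cdot,s)=0$ and $W(\cdot,\infty):=\lim_{s\to\infty}W(\cdot,s)=r^*$ (limits in $Y$). Conditions on a map $Q:C_+\to C_+$: (A1) $T_{-y}\circ Q[\varphi]\ge Q\circ T_{-y}[\varphi]$ for all $\varphi\in C_+$, $y\ge0$. (A2) For every vector $r\in\mathrm{Int}(\mathbb R_+^N)$, $Q|_{C_r}:C_r\to C_+$ is continuous, and monotone: $Q[\phi]\le Q[\psi]$ whenever $\phi\le\psi$ in $C_r$. By (A1), $T_{-y}\circ Q\circ T_y[\varphi](\theta,x)$ is nondecreasing in $y$; define $Q_\pm:C_+\to L^\infty(M\times\mathbb R,\mathbb R^N)$ by $Q_\pm[\varphi](\theta,x)=\lim_{y\to\pm\infty}T_{-y}\circ Q\circ T_y[\varphi](\theta,x)$. (A3) For all $\varphi\in C_+$, $n\in\mathbb N$: $T_{-y}\circ Q^n\circ T_y[\varphi]\to Q_\pm^n[\varphi]$ in $C$ as $y\to\pm\infty$. (A4) For every vector $r\in\mathrm{Int}(\mathbb R^N_+)$, $Q_\pm|_{C_r}:C_r\to C_+$ is continuous, $Q_+[0]=0$, and $Q_+[r^*]=r^*$ for some $r^*\in\mathrm{Int}(Y_+)$ (fixed). Properties: (SP) There is $N^*>0$ such that $Q^n[\varphi](\theta,x)\in\mathrm{Int}(\mathbb R^N_+)$ for all $n\ge N^*$, $(\theta,x)\in M\times(0,\infty)$,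 $\varphi\in C_+\setminus\{0\}$. (UC) There are $c_-^*,c_+^*\in\mathbb R$ with $c_+^*+c_-^*>0$ and $\lim_{n\to\infty}\max_{x\in n[-c_-^*+\varepsilon,\,c_+^*-\varepsilon]}\|Q_+^n[\varphi](\cdot,x)-r^*\|_Y=0$ for all $\varepsilon\in(0,\frac{c_+^*+c_-^*}{2})$ and $\varphi\in C_+\setminus\{0\}$. (UAA) $\lim_{n\to\infty}\sup_{(\theta,x)\in M\times\mathbb R}Q_-^n[\varphi](\theta,x)=0$ for all $\varphi\in C_+$. Subhomogeneity: $Q$ is subhomogeneous on $[0,r^*]_C$ if $Q[\kappa\phi]\ge\kappa Q[\phi]$ for all $\kappa\in[0,1]$, $\phi\in[0,r^*]_C$. (ASH-UC-SP) There are sequences $\{c_{\pm l}^*\}_{l\ge1}$ in $\mathbb R$, $\{r_l^*\}_{l\ge1}$ in $\mathrm{Int}(Y_+)$ and maps $Q_l:C_+\to C_+$ (an auxiliary sequence, not the semiflow at time $l$) such that for every $l\geq 1$: (i) $Q_l$ satisfies (A1) and (A2), $Q_l[0]=0$, and $Q\ge Q_l$ on $C_{r^*}$; (ii) $T_{-y}\circ Q_l\circ T_y[\varphi]\to Q_l^+[\varphi]$ in $C$ as $y\to\infty$ for all $\varphi\in C_+$, where $Q_l^+[r_l^*]=r_l^*\le r^*$; (iii) $Q_l$ is subhomogeneous on $[0,r_l^*]_C$; (iv) $Q_l$ satisfies (SP), and $Q_l^+$ satisfies (UC) with $c_{-l}^*,c_{+l}^*,r_l^*$ in place of $c_-^*,c_+^*,r^*$.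 *)

theory Defs
  imports "HOL-Analysis.Analysis"
begin

section \<open>The spaces\<close>

text \<open>
  The compact space \<open>M\<close> is a type \<open>'m\<close> of class \<^class>\<open>topological_space\<close> (compactness is an
  explicit hypothesis of the theorem), and \<open>N\<close> is the cardinality of a finite type \<open>'n\<close>.
  The order of \<^typ>\<open>real^'n\<close> is componentwise and that of functions pointwise.

  The space \<open>C = C(M, X)\<close> is, as in the source, identified with the bounded continuous functions
  on \<open>M \<times> \<real>\<close>: all elements are bounded jointly in both variables, which mere continuity of
  \<open>M \<rightarrow> X\<close> for the weighted norm of \<open>X\<close> would not give. We keep these functions curried, so that \<open>\<phi> \<theta>\<close> is the corresponding element of \<open>X\<close>.
\<close>

type_synonym ('m, 'n) C_fun = "'m \<Rightarrow> real \<Rightarrow> real^'n"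

definition C_space :: "('m::topological_space, 'n::finite) C_fun set" where
  "C_space = {\<phi>. (\<lambda>(\<theta>, x). \<phi> \<theta> x) \<in> bcontfun}"

definition C_plus :: "('m::topological_space, 'n::finite) C_fun set" where
  "C_plus = {\<phi> \<in> C_space. \<forall>\<theta> x. 0 \<le> \<phi> \<theta> x}"

text \<open>The source sums over \<open>n \<ge> 1\<close>; here the summation index is shifted by one.\<close>

definition norm_X :: "(real \<Rightarrow> real^'n) \<Rightarrow> real" where
  "norm_X f = (\<Sum>n. (1/2) ^ Suc n * (SUP x\<in>{- real (Suc n)..real (Suc n)}. norm (f x)))"

definition norm_C :: "('m, 'n::finite) C_fun \<Rightarrow> real" where
  "norm_C \<phi> = (SUP \<theta>. norm_X (\<phi> \<theta>))"

text \<open>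
  The value outside \<^term>\<open>C_space\<close> is irrelevant; it is set to \<open>0\<close> only because the locale
  \<^locale>\<open>Metric_space\<close> asks for nonnegativity on the whole type.
\<close>

definition dist_C ::
    "('m::topological_space, 'n::finite) C_fun \<Rightarrow> ('m, 'n) C_fun \<Rightarrow> real" where
  "dist_C \<phi> \<psi> = (if \<phi> \<in> C_space \<and> \<psi> \<in> C_space then norm_C (\<lambda>\<theta> x. \<phi> \<theta> x - \<psi> \<theta> x) else 0)"

definition C_top :: "('m::topological_space, 'n::finite) C_fun topology" where
  "C_top = Metric_space.mtopology C_space dist_C"

definition precompact_C :: "('m::topological_space, 'n::finite) C_fun set \<Rightarrow> bool" where
  "precompact_C S \<longleftrightarrow> S \<subseteq> C_space \<and> compactin C_top (C_top closure_of S)"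

definition Int_RN_plus :: "(real^'n) set" where
  "Int_RN_plus = interior {v. 0 \<le> v}"

definition Int_Y_plus :: "('m::topological_space \<Rightarrow> real^'n) set" where
  "Int_Y_plus = {\<beta>. continuous_on UNIV \<beta> \<and> (\<forall>\<theta>. \<beta> \<theta> \<in> Int_RN_plus)}"

definition norm_Y :: "('m \<Rightarrow> real^'n) \<Rightarrow> real" where
  "norm_Y \<beta> = (SUP \<theta>. norm (\<beta> \<theta>))"

text \<open>The identifications of vectors and of elements of \<open>Y\<close> with elements of \<open>C\<close>.\<close>

definition of_vec :: "real^'n \<Rightarrow> ('m, 'n) C_fun" where
  "of_vec v = (\<lambda>\<theta> x. v)"

definition of_Y :: "('m \<Rightarrow> real^'n) \<Rightarrow> ('m, 'n) C_fun" where
  "of_Y \<beta> = (\<lambda>\<theta> x. \<beta> \<theta>)"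

definition C_interval ::
    "('m::topological_space, 'n::finite) C_fun \<Rightarrow> ('m, 'n) C_fun set" where
  "C_interval \<psi> = {\<phi> \<in> C_space. of_vec 0 \<le> \<phi> \<and> \<phi> \<le> \<psi>}"

definition translate :: "real \<Rightarrow> ('m, 'n) C_fun \<Rightarrow> ('m, 'n) C_fun" where
  "translate y \<phi> = (\<lambda>\<theta> x. \<phi> \<theta> (x - y))"


subsection \<open>The metric on \<open>C\<close>\<close>

lemma C_space_bounded:
  assumes "\<phi> \<in> C_space"
  shows "\<exists>B. \<forall>\<theta> x. norm (\<phi> \<theta> x) \<le> B"
  using assms unfolding C_space_def bcontfun_def bounded_iff by force

lemma C_space_diff:
  assumes "\<phi> \<in> C_space" "\<psi> \<in> C_space"
  shows "(\<lambda>\<theta> x. \<phi> \<theta> x - \<psi> \<theta> x) \<in> C_space"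
  using minus_cont[of "\<lambda>(\<theta>, x). \<phi> \<theta> x" "\<lambda>(\<theta>, x). \<psi> \<theta> x"] assms
  by (simp add: C_space_def case_prod_unfold)

lemma norm_X_bounds:
  fixes f :: "real \<Rightarrow> real^'n"
  assumes B: "\<And>x. norm (f x) \<le> B"
  shows norm_X_SUP_le: "(SUP x\<in>{- real (Suc n)..real (Suc n)}. norm (f x)) \<le> B"
    and norm_X_le_SUP: "\<bar>x\<bar> \<le> real (Suc n) \<Longrightarrow>
      norm (f x) \<le> (SUP x\<in>{- real (Suc n)..real (Suc n)}. norm (f x))"
    and norm_X_SUP_nonneg: "0 \<le> (SUP x\<in>{- real (Suc n)..real (Suc n)}. norm (f x))"
proof -
  have bdd: "bdd_above ((\<lambda>x. norm (f x)) ` {- real (Suc n)..real (Suc n)})"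
    using B by (auto intro!: bdd_aboveI2)
  show "(SUP x\<in>{- real (Suc n)..real (Suc n)}. norm (f x)) \<le> B"
    using B by (intro cSUP_least) auto
  show *: "norm (f x) \<le> (SUP x\<in>{- real (Suc n)..real (Suc n)}. norm (f x))"
    if "\<bar>x\<bar> \<le> real (Suc n)" for x
    using that by (intro cSUP_upper bdd) auto
  show "0 \<le> (SUP x\<in>{- real (Suc n)..real (Suc n)}. norm (f x))"
    using order_trans[OF norm_ge_zero *[of 0]] by simp
qed

lemma norm_X_summable:
  fixes f :: "real \<Rightarrow> real^'n"
  assumes B: "\<And>x. norm (f x) \<le> B"
  shows "summable (\<lambda>n. (1/2) ^ Suc n * (SUP x\<in>{- real (Suc n)..real (Suc n)}. norm (f x)))"
proof (rule summable_comparison_test')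
  show "summable (\<lambda>n. (1/2::real) ^ Suc n * B)"
    by (intro summable_mult2) (simp add: summable_geometric)
  show "norm ((1/2) ^ Suc n * (SUP x\<in>{- real (Suc n)..real (Suc n)}. norm (f x)))
          \<le> (1/2::real) ^ Suc n * B" if "n \<ge> 0" for n
  proof -
    have "(1/2::real) ^ Suc n * (SUP x\<in>{- real (Suc n)..real (Suc n)}. norm (f x))
        \<le> (1/2) ^ Suc n * B"
      by (intro mult_left_mono norm_X_SUP_le B) auto
    moreover have "0 \<le> (1/2::real) ^ Suc n * (SUP x\<in>{- real (Suc n)..real (Suc n)}. norm (f x))"
      by (intro mult_nonneg_nonneg norm_X_SUP_nonneg[OF B]) auto
    ultimately show ?thesis by simp
  qed
qed

lemma norm_X_nonneg:
  fixes f :: "real \<Rightarrow> real^'n"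
  assumes B: "\<And>x. norm (f x) \<le> B"
  shows "0 \<le> norm_X f"
  unfolding norm_X_def
  by (intro suminf_nonneg norm_X_summable[OF B] mult_nonneg_nonneg norm_X_SUP_nonneg[OF B]) auto

lemma norm_X_le:
  fixes f :: "real \<Rightarrow> real^'n"
  assumes B: "\<And>x. norm (f x) \<le> B"
  shows "norm_X f \<le> B"
proof -
  have s: "(\<lambda>n. (1/2::real) ^ Suc n * B) sums (1 * B)"
    by (intro sums_mult2 power_half_series)
  have "norm_X f \<le> (\<Sum>n. (1/2::real) ^ Suc n * B)"
    unfolding norm_X_def
    by (intro suminf_le norm_X_summable[OF B] sums_summable[OF s] mult_left_mono
        norm_X_SUP_le B) auto
  also have "\<dots> = B" using sums_unique[OF s] by simp
  finally show ?thesis .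
qed

lemma norm_le_norm_X:
  fixes f :: "real \<Rightarrow> real^'n"
  assumes B: "\<And>x. norm (f x) \<le> B" and x: "\<bar>x\<bar> \<le> real (Suc n)"
  shows "norm (f x) \<le> 2 ^ Suc n * norm_X f"
proof -
  let ?S = "\<lambda>n. SUP x\<in>{- real (Suc n)..real (Suc n)}. norm (f x)"
  have "sum (\<lambda>n. (1/2) ^ Suc n * ?S n) {n} \<le> norm_X f"
    unfolding norm_X_def
    by (rule sum_le_suminf[OF norm_X_summable[OF B]])
       (auto intro!: mult_nonneg_nonneg norm_X_SUP_nonneg[OF B, simplified])
  hence "(1/2) ^ Suc n * ?S n \<le> norm_X f" by simp
  hence "?S n \<le> 2 ^ Suc n * norm_X f"
    by (simp add: power_divide field_simps)
  thus ?thesis using norm_X_le_SUP[of f, OF B x] by linarith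
qed

lemma norm_X_triangle:
  fixes f g :: "real \<Rightarrow> real^'n"
  assumes A: "\<And>x. norm (f x) \<le> A" and B: "\<And>x. norm (g x) \<le> B"
  shows "norm_X (\<lambda>x. f x + g x) \<le> norm_X f + norm_X g"
proof -
  have AB: "norm (f x + g x) \<le> A + B" for x
    using A[of x] B[of x] norm_triangle_ineq[of "f x" "g x"] by linarith
  show ?thesis
    unfolding norm_X_def suminf_add[OF norm_X_summable[OF A] norm_X_summable[OF B]]
  proof (intro suminf_le norm_X_summable[OF AB] summable_add
      norm_X_summable[OF A] norm_X_summable[OF B])
    fix n
    have "(SUP x\<in>{- real (Suc n)..real (Suc n)}. norm (f x + g x))
        \<le> (SUP x\<in>{- real (Suc n)..real (Suc n)}. norm (f x))
          + (SUP x\<in>{- real (Suc n)..real (Suc n)}. norm (g x))"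
    proof (rule cSUP_least)
      fix x assume "x \<in> {- real (Suc n)..real (Suc n)}"
      hence x: "\<bar>x\<bar> \<le> real (Suc n)" by auto
      show "norm (f x + g x) \<le> (SUP x\<in>{- real (Suc n)..real (Suc n)}. norm (f x))
          + (SUP x\<in>{- real (Suc n)..real (Suc n)}. norm (g x))"
        using norm_triangle_ineq[of "f x" "g x"] norm_X_le_SUP[of f, OF A x]
          norm_X_le_SUP[of g, OF B x] by linarith
    qed auto
    hence "(1/2::real) ^ Suc n * (SUP x\<in>{- real (Suc n)..real (Suc n)}. norm (f x + g x))
        \<le> (1/2) ^ Suc n * ((SUP x\<in>{- real (Suc n)..real (Suc n)}. norm (f x))
          + (SUP x\<in>{- real (Suc n)..real (Suc n)}. norm (g x)))"
      by (intro mult_left_mono) auto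
    thus "(1/2::real) ^ Suc n * (SUP x\<in>{- real (Suc n)..real (Suc n)}. norm (f x + g x))
        \<le> (1/2) ^ Suc n * (SUP x\<in>{- real (Suc n)..real (Suc n)}. norm (f x))
          + (1/2) ^ Suc n * (SUP x\<in>{- real (Suc n)..real (Suc n)}. norm (g x))"
      by (simp only: distrib_left)
  qed
qed

lemma norm_X_le_norm_C:
  assumes "\<phi> \<in> C_space"
  shows "norm_X (\<phi> \<theta>) \<le> norm_C \<phi>"
proof -
  obtain B where B: "\<And>\<theta> x. norm (\<phi> \<theta> x) \<le> B" using C_space_bounded[OF assms] by blast
  show ?thesis unfolding norm_C_def
    by (intro cSUP_upper bdd_aboveI2[of _ _ B] norm_X_le B) auto
qed

lemma norm_C_nonneg:
  assumes "\<phi> \<in> C_space"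
  shows "0 \<le> norm_C \<phi>"
proof -
  obtain B where B: "\<And>\<theta> x. norm (\<phi> \<theta> x) \<le> B" using C_space_bounded[OF assms] by blast
  show ?thesis
    using norm_X_nonneg[OF B] norm_X_le_norm_C[OF assms] by (meson order_trans)
qed

lemma norm_C_triangle:
  assumes "\<phi> \<in> C_space" "\<psi> \<in> C_space"
  shows "norm_C (\<lambda>\<theta> x. \<phi> \<theta> x + \<psi> \<theta> x) \<le> norm_C \<phi> + norm_C \<psi>"
proof -
  obtain A where A: "\<And>\<theta> x. norm (\<phi> \<theta> x) \<le> A" using C_space_bounded[OF assms(1)] by blast
  obtain B where B: "\<And>\<theta> x. norm (\<psi> \<theta> x) \<le> B" using C_space_bounded[OF assms(2)] by blast
  have "norm_X (\<lambda>x. \<phi> \<theta> x + \<psi> \<theta> x) \<le> norm_C \<phi> + norm_C \<psi>" for \<theta>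
    using norm_X_triangle[of "\<phi> \<theta>" A "\<psi> \<theta>" B, OF A B]
      norm_X_le_norm_C[OF assms(1), of \<theta>] norm_X_le_norm_C[OF assms(2), of \<theta>] by linarith
  thus ?thesis unfolding norm_C_def[of "\<lambda>\<theta> x. \<phi> \<theta> x + \<psi> \<theta> x"]
    by (intro cSUP_least) auto
qed

lemma Metric_space_C: "Metric_space C_space dist_C"
proof
  fix \<phi> \<psi> \<eta> :: "('a, 'b) C_fun"
  show "0 \<le> dist_C \<phi> \<psi>"
    by (simp add: dist_C_def norm_C_nonneg C_space_diff)
  show "dist_C \<phi> \<psi> = dist_C \<psi> \<phi>"
    by (simp add: dist_C_def norm_C_def norm_X_def norm_minus_commute)
  show "dist_C \<phi> \<psi> = 0 \<longleftrightarrow> \<phi> = \<psi>" if "\<phi> \<in> C_space" "\<psi> \<in> C_space"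
  proof
    let ?d = "\<lambda>\<theta> x. \<phi> \<theta> x - \<psi> \<theta> x"
    assume "dist_C \<phi> \<psi> = 0"
    hence 0: "norm_C ?d = 0" using that by (simp add: dist_C_def)
    have d: "?d \<in> C_space" using that by (rule C_space_diff)
    obtain B where B: "\<And>\<theta> x. norm (?d \<theta> x) \<le> B" using C_space_bounded[OF d] by blast
    show "\<phi> = \<psi>"
    proof (intro ext)
      fix \<theta> x
      obtain n where "\<bar>x\<bar> \<le> real n" using real_arch_simple by blast
      hence "\<bar>x\<bar> \<le> real (Suc n)" by simp
      hence "norm (?d \<theta> x) \<le> 2 ^ Suc n * norm_X (?d \<theta>)"
        by (rule norm_le_norm_X[of "?d \<theta>", OF B])
      also have "\<dots> \<le> 2 ^ Suc n * 0"
        using norm_X_le_norm_C[OF d, of \<theta>] 0 by (intro mult_left_mono) auto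
      finally show "\<phi> \<theta> x = \<psi> \<theta> x" by simp
    qed
  next
    assume "\<phi> = \<psi>"
    thus "dist_C \<phi> \<psi> = 0" by (simp add: dist_C_def norm_C_def norm_X_def)
  qed
  show "dist_C \<phi> \<eta> \<le> dist_C \<phi> \<psi> + dist_C \<psi> \<eta>"
    if "\<phi> \<in> C_space" "\<psi> \<in> C_space" "\<eta> \<in> C_space"
    using norm_C_triangle[OF C_space_diff[OF that(1,2)] C_space_diff[OF that(2,3)]] that
    by (simp add: dist_C_def)
qed


section \<open>Semiflows and equilibria\<close>

definition semiflow ::
    "(real \<Rightarrow> ('m::topological_space, 'n::finite) C_fun \<Rightarrow> ('m, 'n) C_fun) \<Rightarrow> bool" where
  "semiflow Q \<longleftrightarrow>
     (\<forall>t\<ge>0. Q t \<in> C_plus \<rightarrow> C_plus) \<and>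
     (\<forall>r\<in>Int_RN_plus.
        continuous_map
          (prod_topology (top_of_set {0..}) (subtopology C_top (C_interval (of_vec r))))
          (subtopology C_top C_plus)
          (\<lambda>(t, \<phi>). Q t \<phi>)) \<and>
     (\<forall>\<phi>\<in>C_plus. Q 0 \<phi> = \<phi>) \<and>
     (\<forall>t\<ge>0. \<forall>s\<ge>0. \<forall>\<phi>\<in>C_plus. Q t (Q s \<phi>) = Q (t + s) \<phi>)"

definition equilibrium ::
    "(real \<Rightarrow> ('m::topological_space, 'n::finite) C_fun \<Rightarrow> ('m, 'n) C_fun) \<Rightarrow>
     ('m, 'n) C_fun \<Rightarrow> bool" where
  "equilibrium Q W \<longleftrightarrow> W \<in> C_plus \<and> (\<forall>t\<ge>0. Q t W = W)"

text \<open>Convergence in \<open>Y\<close> is uniform convergence on \<open>M\<close>.\<close>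

definition connects_zero_to ::
    "('m, 'n::finite) C_fun \<Rightarrow> ('m \<Rightarrow> real^'n) \<Rightarrow> bool" where
  "connects_zero_to W r \<longleftrightarrow>
     uniform_limit UNIV (\<lambda>s \<theta>. W \<theta> s) (\<lambda>\<theta>. 0) at_bot \<and>
     uniform_limit UNIV (\<lambda>s \<theta>. W \<theta> s) r at_top"


section \<open>Conditions on a map\<close>

definition A1 ::
    "(('m::topological_space, 'n::finite) C_fun \<Rightarrow> ('m, 'n) C_fun) \<Rightarrow> bool" where
  "A1 Q \<longleftrightarrow> (\<forall>\<phi>\<in>C_plus. \<forall>y\<ge>0. Q (translate (-y) \<phi>) \<le> translate (-y) (Q \<phi>))"

definition A2 ::
    "(('m::topological_space, 'n::finite) C_fun \<Rightarrow> ('m, 'n) C_fun) \<Rightarrow> bool" where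
  "A2 Q \<longleftrightarrow>
     (\<forall>r\<in>Int_RN_plus.
        continuous_map (subtopology C_top (C_interval (of_vec r))) (subtopology C_top C_plus) Q \<and>
        (\<forall>\<phi>\<in>C_interval (of_vec r). \<forall>\<psi>\<in>C_interval (of_vec r). \<phi> \<le> \<psi> \<longrightarrow> Q \<phi> \<le> Q \<psi>))"

text \<open>
  \<open>Q\<^sub>+\<close> and \<open>Q\<^sub>-\<close> are the pointwise limits below. The constant \<^const>\<open>Lim\<close> is unspecified where the
  limit does not exist, but wherever these maps are used a convergence in \<open>C\<close> to their values
  is required, which makes the pointwise limits exist.
\<close>

definition Q_lim_plus ::
    "(('m, 'n::finite) C_fun \<Rightarrow> ('m, 'n) C_fun) \<Rightarrow> ('m, 'n) C_fun \<Rightarrow> ('m, 'n) C_fun" where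
  "Q_lim_plus Q \<phi> = (\<lambda>\<theta> x. Lim at_top (\<lambda>y. translate (-y) (Q (translate y \<phi>)) \<theta> x))"

definition Q_lim_minus ::
    "(('m, 'n::finite) C_fun \<Rightarrow> ('m, 'n) C_fun) \<Rightarrow> ('m, 'n) C_fun \<Rightarrow> ('m, 'n) C_fun" where
  "Q_lim_minus Q \<phi> = (\<lambda>\<theta> x. Lim at_bot (\<lambda>y. translate (-y) (Q (translate y \<phi>)) \<theta> x))"

definition A3 ::
    "(('m::topological_space, 'n::finite) C_fun \<Rightarrow> ('m, 'n) C_fun) \<Rightarrow> bool" where
  "A3 Q \<longleftrightarrow>
     (\<forall>\<phi>\<in>C_plus. \<forall>n.
        limitin C_top (\<lambda>y. translate (-y) ((Q ^^ n) (translate y \<phi>)))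
          ((Q_lim_plus Q ^^ n) \<phi>) at_top \<and>
        limitin C_top (\<lambda>y. translate (-y) ((Q ^^ n) (translate y \<phi>)))
          ((Q_lim_minus Q ^^ n) \<phi>) at_bot)"

definition A4 ::
    "(('m::topological_space, 'n::finite) C_fun \<Rightarrow> ('m, 'n) C_fun) \<Rightarrow>
     ('m \<Rightarrow> real^'n) \<Rightarrow> bool" where
  "A4 Q rstar \<longleftrightarrow>
     (\<forall>r\<in>Int_RN_plus.
        continuous_map (subtopology C_top (C_interval (of_vec r))) (subtopology C_top C_plus)
          (Q_lim_plus Q) \<and>
        continuous_map (subtopology C_top (C_interval (of_vec r))) (subtopology C_top C_plus)
          (Q_lim_minus Q)) \<and>
     Q_lim_plus Q (of_vec 0) = of_vec 0 \<and>
     rstar \<in> Int_Y_plus \<and>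
     Q_lim_plus Q (of_Y rstar) = of_Y rstar"

definition SP ::
    "(('m::topological_space, 'n::finite) C_fun \<Rightarrow> ('m, 'n) C_fun) \<Rightarrow> bool" where
  "SP Q \<longleftrightarrow>
     (\<exists>Nstar>0. \<forall>n\<ge>Nstar. \<forall>\<theta>. \<forall>x>0. \<forall>\<phi>\<in>C_plus - {of_vec 0}. (Q ^^ n) \<phi> \<theta> x \<in> Int_RN_plus)"

text \<open>\<open>UC P r cm cp\<close>: the map \<open>P\<close> (which will be \<open>Q\<^sub>+\<close>) satisfies (UC) with limit \<open>r\<close> and
  constants \<open>cm = c\<^sub>-\<^sup>*\<close>, \<open>cp = c\<^sub>+\<^sup>*\<close>.\<close>

definition UC ::
    "(('m::topological_space, 'n::finite) C_fun \<Rightarrow> ('m, 'n) C_fun) \<Rightarrow>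
     ('m \<Rightarrow> real^'n) \<Rightarrow> real \<Rightarrow> real \<Rightarrow> bool" where
  "UC P r cm cp \<longleftrightarrow>
     cp + cm > 0 \<and>
     (\<forall>\<epsilon>\<in>{0<..<(cp + cm) / 2}. \<forall>\<phi>\<in>C_plus - {of_vec 0}.
        (\<lambda>n. SUP x\<in>{real n * (- cm + \<epsilon>)..real n * (cp - \<epsilon>)}. norm_Y (\<lambda>\<theta>. (P ^^ n) \<phi> \<theta> x - r \<theta>))
          \<longlonglongrightarrow> 0)"

text \<open>The supremum in \<^typ>\<open>real^'n\<close> is componentwise.\<close>

definition UAA ::
    "(('m::topological_space, 'n::finite) C_fun \<Rightarrow> ('m, 'n) C_fun) \<Rightarrow> bool" where
  "UAA P \<longleftrightarrow> (\<forall>\<phi>\<in>C_plus. (\<lambda>n. SUP (\<theta>, x)\<in>UNIV. (P ^^ n) \<phi> \<theta> x) \<longlonglongrightarrow> 0)"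

definition subhomogeneous ::
    "(('m::topological_space, 'n::finite) C_fun \<Rightarrow> ('m, 'n) C_fun) \<Rightarrow>
     ('m \<Rightarrow> real^'n) \<Rightarrow> bool" where
  "subhomogeneous Q r \<longleftrightarrow>
     (\<forall>\<kappa>\<in>{0..1}. \<forall>\<phi>\<in>C_interval (of_Y r).
        (\<lambda>\<theta> x. \<kappa> *\<^sub>R Q \<phi> \<theta> x) \<le> Q (\<lambda>\<theta> x. \<kappa> *\<^sub>R \<phi> \<theta> x))"

text \<open>
  Condition (ASH-UC-SP) for \<open>Q\<close> and \<open>r\<^sup>*\<close>, with approximating speeds \<open>cml l = c\<^sup>*\<^sub>-\<^sub>l\<close> and
  \<open>cpl l = c\<^sup>*\<^sub>+\<^sub>l\<close>. The speeds are arguments so that their limits can be referred to.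
\<close>

definition ASH_UC_SP ::
    "(('m::topological_space, 'n::finite) C_fun \<Rightarrow> ('m, 'n) C_fun) \<Rightarrow>
     ('m \<Rightarrow> real^'n) \<Rightarrow> (nat \<Rightarrow> real) \<Rightarrow> (nat \<Rightarrow> real) \<Rightarrow> bool" where
  "ASH_UC_SP Q rstar cml cpl \<longleftrightarrow>
     (\<exists>(rl :: nat \<Rightarrow> 'm \<Rightarrow> real^'n) (Ql :: nat \<Rightarrow> ('m, 'n) C_fun \<Rightarrow> ('m, 'n) C_fun). \<forall>l\<ge>1.
        rl l \<in> Int_Y_plus \<and> Ql l \<in> C_plus \<rightarrow> C_plus \<and>
        A1 (Ql l) \<and> A2 (Ql l) \<and> Ql l (of_vec 0) = of_vec 0 \<and>
        (\<forall>\<phi>\<in>C_interval (of_Y rstar). Ql l \<phi> \<le> Q \<phi>) \<and>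
        (\<forall>\<phi>\<in>C_plus. limitin C_top (\<lambda>y. translate (-y) (Ql l (translate y \<phi>)))
                       (Q_lim_plus (Ql l) \<phi>) at_top) \<and>
        Q_lim_plus (Ql l) (of_Y (rl l)) = of_Y (rl l) \<and> rl l \<le> rstar \<and>
        subhomogeneous (Ql l) (rl l) \<and>
        SP (Ql l) \<and>
        UC (Q_lim_plus (Ql l)) (rl l) (cml l) (cpl l))"

end

theory Submission
  imports Defs
begin

text \<open>
  The equilibrium is \<open>W = lim Q\<^sub>t [r*]\<close> as \<open>t \<rightarrow> \<infinity>\<close>. Since \<open>Q\<^sub>t [r*] \<le> r*\<close> for all \<open>t\<close>, the semigroup
  law and monotonicity make \<open>Q\<^sub>t [r*]\<close> nonincreasing in \<open>t\<close>; precompactness of the orbit of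
  \<open>Q = Q\<^sub>t\<^sub>0\<close> then yields a limit in \<open>C\<close>, and it is fixed by \<^emph>\<open>every\<close> \<open>Q\<^sub>t\<close> because \<open>Q\<^sub>t Q\<^sup>n [r*]\<close> is
  squeezed between a later and an earlier member of the same sequence
  (\<open>semiflow_decreasing_limit_equilibrium\<close>).

  The limit at \<open>-\<infinity>\<close> is a comparison: \<open>W \<le> Q\<^sup>n [r*]\<close>, far to the left \<open>Q\<^sup>n [r*]\<close> looks like
  \<open>Q\<^sub>-\<^sup>n [r*]\<close> by (A3), and the latter is small for large \<open>n\<close> by (UAA)
  (\<open>UAA_tendsto_zero_at_bot\<close>).

  The limit at \<open>+\<infinity>\<close> rests on a barrier that prevents the decreasing sequence \<open>Q\<^sup>n [r*]\<close> from
  collapsing. Choose a speed \<open>x0\<close> with \<open>-c\<^sub>+\<^sup>* < x0 < c\<^sub>-\<^sup>*\<close> and \<open>x0 \<ge> 0\<close>, which exists because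
  \<open>c\<^sub>-\<^sup>* > 0\<close> and \<open>c\<^sub>+\<^sup>* + c\<^sub>-\<^sup>* > 0\<close>, and a small tent \<open>\<phi> \<le> r*/2\<close>. In the frame moving to the left with speed \<open>x0\<close> the
  functions \<open>Q\<^sub>+\<^sup>n [\<phi>]\<close> converge to \<open>r*\<close> locally uniformly, by (UC). By (A3) the same holds up to a
  small error for \<open>Q\<^sup>n\<close> started from a translate \<open>T\<^sub>y [\<phi>]\<close> with \<open>y\<close> large. So for one fixed \<open>n\<close>
  and all large \<open>y\<close> the function \<open>Q\<^sup>n [T\<^sub>y \<phi>]\<close> exceeds the tent centred at \<open>y - n x0\<close>. On its own this
  tent might drift out of the region of large \<open>y\<close>; but (A1) makes all iterates of \<open>r*\<close>
  nondecreasing in \<open>x\<close>, and a function nondecreasing in \<open>x\<close> that lies above the tent at \<open>y - n x0\<close>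
  also lies above the tent at \<open>y\<close>. Hence the family \<open>T\<^sub>y [\<phi>]\<close>, \<open>y\<close> large, stays below all iterates
  (\<open>tent_barrier\<close>) and below \<open>W\<close>. Finally \<open>r* \<ge> W = Q\<^sup>n [W] \<ge> Q\<^sup>n [T\<^sub>y \<phi>]\<close>, and the right side, seen
  at a suitable point moving with \<open>y\<close>, is close to \<open>r*\<close> (\<open>UC_tendsto_at_top\<close>).
\<close>

section \<open>Order and norm in \<open>\<real>\<^sup>N\<close>\<close>

lemma norm_le_norm_nonneg:
  fixes a b :: "real^'n"
  assumes "0 \<le> a" "a \<le> b"
  shows "norm a \<le> norm b"
proof (rule norm_le_componentwise_cart)
  fix i
  have "0 \<le> a $ i" "a $ i \<le> b $ i" using assms by (auto simp: less_eq_vec_def)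
  thus "norm (a $ i) \<le> norm (b $ i)" by simp
qed

lemma Int_RN_plus_iff: "v \<in> Int_RN_plus \<longleftrightarrow> (\<forall>i. 0 < v $ i)"
  for v :: "real^'n"
proof
  assume "v \<in> Int_RN_plus"
  then obtain e where e: "e > 0" "ball v e \<subseteq> {v. 0 \<le> v}"
    unfolding Int_RN_plus_def mem_interior by blast
  show "\<forall>i. 0 < v $ i"
  proof
    fix i
    have "dist v (v - axis i (e/2)) < e" using e(1)
      by (simp add: dist_norm axis_def norm_vec_def L2_set_def if_distrib[of "\<lambda>x. x\<^sup>2"] cong: if_cong)
    hence "v - axis i (e/2) \<in> {v. 0 \<le> v}" using e(2) by (meson mem_ball subsetD)
    hence "0 \<le> (v - axis i (e/2)) $ i" by (simp only: mem_Collect_eq less_eq_vec_def zero_index)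
    thus "0 < v $ i" using e(1) by simp
  qed
next
  assume *: "\<forall>i. 0 < v $ i"
  have "{v :: real^'n. \<forall>i. 0 < v $ i} = (\<Inter>i. {v. 0 < v $ i})" by auto
  hence "open {v :: real^'n. \<forall>i. 0 < v $ i}"
    by (simp only:) (intro open_INT finite_class.finite_UNIV ballI open_halfspace_component_gt_cart)
  hence "{v :: real^'n. \<forall>i. 0 < v $ i} \<subseteq> Int_RN_plus" unfolding Int_RN_plus_def
    by (intro interior_maximal) (auto simp: less_eq_vec_def less_imp_le)
  thus "v \<in> Int_RN_plus" using * by blast
qed

section \<open>The space \<open>C\<close> and its positive cone\<close>

lemma topspace_C_top [simp]: "topspace C_top = C_space"
  unfolding C_top_def by (rule Metric_space.topspace_mtopology[OF Metric_space_C])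

lemma C_plusD:
  assumes "\<phi> \<in> C_plus"
  shows "\<phi> \<in> C_space" "0 \<le> \<phi> \<theta> x"
  using assms by (auto simp: C_plus_def)

lemma C_spaceI:
  assumes "continuous_on UNIV (\<lambda>(\<theta>, x). \<phi> \<theta> x)" "\<And>\<theta> x. norm (\<phi> \<theta> x) \<le> B"
  shows "\<phi> \<in> C_space"
  using assms unfolding C_space_def bcontfun_def bounded_iff by force

lemma C_space_continuous:
  assumes "\<phi> \<in> C_space"
  shows "continuous_on UNIV (\<lambda>(\<theta>, x). \<phi> \<theta> x)"
  using assms unfolding C_space_def bcontfun_def by simp

lemma translate_C_plus:
  assumes "\<phi> \<in> C_plus"
  shows "translate y \<phi> \<in> C_plus"
proof -
  obtain B where B: "\<And>\<theta> x. norm (\<phi> \<theta> x) \<le> B"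
    using C_space_bounded[OF C_plusD(1)[OF assms]] by blast
  have "continuous_on UNIV (\<lambda>p. (\<lambda>(\<theta>, x). \<phi> \<theta> x) (fst p, snd p - y))"
    by (rule continuous_on_compose2[OF C_space_continuous[OF C_plusD(1)[OF assms]]])
       (auto intro!: continuous_intros)
  hence "translate y \<phi> \<in> C_space"
    by (intro C_spaceI[of _ B]) (auto simp: translate_def case_prod_unfold B)
  thus ?thesis using C_plusD(2)[OF assms] by (simp add: C_plus_def translate_def)
qed

text \<open>
  (A2) speaks of the sets \<open>C\<^sub>r\<close> with \<open>r\<close> a constant vector. As elements of \<open>C\<close> are bounded, every
  order interval \<open>[0, \<phi>]\<close> lies in one of them, so monotonicity and continuity hold on all of
  \<open>C\<^sub>+\<close>, the latter along families bounded by an element of \<open>C\<^sub>+\<close>.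
\<close>

lemma C_plus_in_C_interval:
  assumes "\<phi> \<in> C_plus"
  obtains r where "r \<in> Int_RN_plus"
    "\<And>\<psi>. \<psi> \<in> C_plus \<Longrightarrow> \<psi> \<le> \<phi> \<Longrightarrow> \<psi> \<in> C_interval (of_vec r)"
proof -
  obtain B where B: "\<And>\<theta> x. norm (\<phi> \<theta> x) \<le> B"
    using C_space_bounded[OF C_plusD(1)[OF assms]] by blast
  define r :: "real^'b" where "r = vec (\<bar>B\<bar> + 1)"
  have le: "\<phi> \<theta> x \<le> r" for \<theta> x
    unfolding less_eq_vec_def
  proof
    fix i
    have "\<phi> \<theta> x $ i \<le> norm (\<phi> \<theta> x)"
      using component_le_norm_cart[of "\<phi> \<theta> x" i] by linarith
    also have "\<dots> \<le> r $ i" using B[of \<theta> x] by (simp add: r_def)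
    finally show "\<phi> \<theta> x $ i \<le> r $ i" .
  qed
  show ?thesis
  proof
    show "r \<in> Int_RN_plus" unfolding Int_RN_plus_iff by (auto simp: r_def)
    show "\<psi> \<in> C_interval (of_vec r)" if "\<psi> \<in> C_plus" "\<psi> \<le> \<phi>" for \<psi>
    proof -
      have "\<psi> \<theta> x \<le> r" for \<theta> x
        using that(2) le[of \<theta> x] by (auto simp: le_fun_def intro: order_trans)
      thus ?thesis using that(1) by (simp add: C_interval_def of_vec_def C_plus_def le_fun_def)
    qed
  qed
qed

text \<open>
  The weight of \<open>[-n, n]\<close> in the norm of \<open>X\<close> is \<open>2\<^sup>-\<^sup>n\<close>, so a small distance in \<open>C\<close> controls the
  supremum over each bounded interval, uniformly in \<open>\<theta>\<close>.
\<close>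

lemma limitin_C_top_locally_uniform:
  assumes lim: "limitin C_top f l F" and "e > 0"
  shows "\<forall>\<^sub>F y in F. \<forall>\<theta>. \<forall>x. \<bar>x\<bar> \<le> R \<longrightarrow> norm (f y \<theta> x - l \<theta> x) < e"
proof -
  obtain n where n: "R \<le> real n" using real_arch_simple by blast
  have l: "l \<in> C_space" using lim limitin_topspace[OF lim] by simp
  have "\<forall>\<^sub>F y in F. f y \<in> C_space \<and> dist_C (f y) l < e / 2 ^ Suc n"
    using lim \<open>e > 0\<close> unfolding C_top_def Metric_space.limitin_metric[OF Metric_space_C]
    by simp
  thus ?thesis
  proof (eventually_elim, intro allI impI)
    fix y \<theta> x assume y: "f y \<in> C_space \<and> dist_C (f y) l < e / 2 ^ Suc n" and x: "\<bar>x\<bar> \<le> R"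
    let ?d = "\<lambda>\<theta> x. f y \<theta> x - l \<theta> x"
    have d: "?d \<in> C_space" using y l by (blast intro: C_space_diff)
    obtain B where B: "\<And>\<theta> x. norm (?d \<theta> x) \<le> B" using C_space_bounded[OF d] by blast
    have "norm (?d \<theta> x) \<le> 2 ^ Suc n * norm_X (?d \<theta>)"
      by (rule norm_le_norm_X[of "?d \<theta>", OF B]) (use x n in simp)
    also have "\<dots> \<le> 2 ^ Suc n * norm_C ?d"
      by (intro mult_left_mono norm_X_le_norm_C[OF d]) auto
    also have "\<dots> < e" using y l by (auto simp: dist_C_def field_simps)
    finally show "norm (f y \<theta> x - l \<theta> x) < e" .
  qed
qed

lemma limitin_C_top_pointwise:
  assumes "limitin C_top f l F"
  shows "((\<lambda>y. f y \<theta> x) \<longlongrightarrow> l \<theta> x) F"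
proof (rule tendstoI)
  fix e :: real assume "e > 0"
  show "\<forall>\<^sub>F y in F. dist (f y \<theta> x) (l \<theta> x) < e"
    using limitin_C_top_locally_uniform[OF assms \<open>e > 0\<close>, of "\<bar>x\<bar>"]
    by eventually_elim (simp add: dist_norm)
qed

text \<open>
  Compactness gives a subsequence converging in \<open>C\<close>; monotonicity forces the whole sequence to
  have the same limit at each point.
\<close>

lemma decseq_precompact_converges:
  fixes \<sigma> :: "nat \<Rightarrow> ('m::topological_space, 'n::finite) C_fun"
  assumes dec: "decseq \<sigma>" and pre: "precompact_C (range \<sigma>)"
  obtains W s where "strict_mono s" "limitin C_top (\<sigma> \<circ> s) W sequentially"
    "\<And>\<theta> x. (\<lambda>n. \<sigma> n \<theta> x) \<longlonglongrightarrow> W \<theta> x"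
proof -
  have "range \<sigma> \<subseteq> C_top closure_of (range \<sigma>)"
    using pre by (intro closure_of_subset) (simp add: precompact_C_def)
  then obtain W s where s: "strict_mono s" and W: "limitin C_top (\<sigma> \<circ> s) W sequentially"
    using pre unfolding precompact_C_def C_top_def
      Metric_space.compactin_sequentially[OF Metric_space_C] by metis
  have "(\<lambda>n. \<sigma> n \<theta> x) \<longlonglongrightarrow> W \<theta> x" for \<theta> x
  proof -
    have sub: "(\<lambda>k. \<sigma> (s k) \<theta> x) \<longlonglongrightarrow> W \<theta> x"
      using limitin_C_top_pointwise[OF W] by simp
    have "(\<lambda>n. \<sigma> n \<theta> x $ i) \<longlonglongrightarrow> W \<theta> x $ i" for i
    proof -
      have D: "decseq (\<lambda>n. \<sigma> n \<theta> x $ i)"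
        using decseqD[OF dec] by (simp add: decseq_def le_fun_def less_eq_vec_def)
      have subi: "(\<lambda>k. \<sigma> (s k) \<theta> x $ i) \<longlonglongrightarrow> W \<theta> x $ i"
        by (rule tendsto_vec_nth[OF sub])
      have "W \<theta> x $ i \<le> \<sigma> n \<theta> x $ i" for n
        by (rule tendsto_upperbound[OF subi])
           (use D seq_suble[OF s] in \<open>auto simp: decseq_def eventually_sequentially
              intro!: exI[of _ n] intro: order_trans\<close>)
      then obtain L where L: "(\<lambda>n. \<sigma> n \<theta> x $ i) \<longlonglongrightarrow> L"
        using decseq_convergent[OF D] by blast
      have "(\<lambda>k. \<sigma> (s k) \<theta> x $ i) \<longlonglongrightarrow> L"
        using LIMSEQ_subseq_LIMSEQ[OF L s] by (simp add: o_def)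
      thus ?thesis using L subi LIMSEQ_unique by blast
    qed
    thus ?thesis by (rule vec_tendstoI)
  qed
  thus ?thesis using that s W by blast
qed

section \<open>Iterates of order-preserving maps\<close>

lemma A2_mono_on:
  assumes "A2 P"
  shows "mono_on C_plus P"
proof (rule mono_onI)
  fix \<phi> \<psi> :: "('a, 'b) C_fun" assume *: "\<phi> \<in> C_plus" "\<psi> \<in> C_plus" "\<phi> \<le> \<psi>"
  obtain r where "r \<in> Int_RN_plus"
      "\<And>\<eta>. \<eta> \<in> C_plus \<Longrightarrow> \<eta> \<le> \<psi> \<Longrightarrow> \<eta> \<in> C_interval (of_vec r)"
    by (rule C_plus_in_C_interval[OF *(2)]) blast
  thus "P \<phi> \<le> P \<psi>" using assms * unfolding A2_def by blast
qed

lemma A2_limitin: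
  assumes A2: "A2 P" and s: "\<And>k. s k \<in> C_plus" "\<And>k. s k \<le> \<psi>" and \<psi>: "\<psi> \<in> C_plus"
    and W: "W \<in> C_plus" "W \<le> \<psi>" and lim: "limitin C_top s W F"
  shows "limitin C_top (\<lambda>k. P (s k)) (P W) F"
proof -
  obtain r where r: "r \<in> Int_RN_plus"
      "\<And>\<eta>. \<eta> \<in> C_plus \<Longrightarrow> \<eta> \<le> \<psi> \<Longrightarrow> \<eta> \<in> C_interval (of_vec r)"
    by (rule C_plus_in_C_interval[OF \<psi>]) blast
  have "limitin (subtopology C_top (C_interval (of_vec r))) s W F"
    using lim r(2) s W unfolding limitin_subtopology by simp
  moreover have "continuous_map (subtopology C_top (C_interval (of_vec r)))
      (subtopology C_top C_plus) P"
    using A2 r(1) unfolding A2_def by blast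
  ultimately have "limitin (subtopology C_top C_plus) (P \<circ> s) (P W) F"
    by (rule continuous_map_limit[rotated])
  thus ?thesis unfolding limitin_subtopology by (simp add: o_def)
qed

lemma funpow_C_plus:
  fixes P :: "('m::topological_space, 'n::finite) C_fun \<Rightarrow> ('m, 'n) C_fun"
  assumes "P \<in> C_plus \<rightarrow> C_plus" "\<phi> \<in> C_plus"
  shows "(P ^^ n) \<phi> \<in> C_plus"
  using assms by (induction n) auto

lemma funpow_mono_on_C_plus:
  fixes P :: "('m::topological_space, 'n::finite) C_fun \<Rightarrow> ('m, 'n) C_fun"
  assumes "P \<in> C_plus \<rightarrow> C_plus" "mono_on C_plus P"
  shows "mono_on C_plus (P ^^ n)"
proof (rule mono_onI)
  fix \<phi> \<psi> :: "('m, 'n) C_fun" assume *: "\<phi> \<in> C_plus" "\<psi> \<in> C_plus" "\<phi> \<le> \<psi>"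
  show "(P ^^ n) \<phi> \<le> (P ^^ n) \<psi>"
  proof (induction n)
    case (Suc n)
    then show ?case
      using mono_onD[OF assms(2) funpow_C_plus[OF assms(1) *(1)] funpow_C_plus[OF assms(1) *(2)]]
      by simp
  qed (use * in simp)
qed

text \<open>
  A function nondecreasing in \<open>x\<close> lies below its shifts to the left, and (A1) passes this on:
  \<open>P [\<phi>] \<le> P [T\<^sub>-\<^sub>y \<phi>] \<le> T\<^sub>-\<^sub>y (P [\<phi>])\<close>.
\<close>

lemma A1_preserves_mono:
  fixes P :: "('m::topological_space, 'n::finite) C_fun \<Rightarrow> ('m, 'n) C_fun"
  assumes P: "P \<in> C_plus \<rightarrow> C_plus" "mono_on C_plus P" "A1 P"
    and \<phi>: "\<phi> \<in> C_plus" "\<And>\<theta>. mono (\<phi> \<theta>)"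
  shows "mono (P \<phi> \<theta>)"
proof (rule monoI)
  fix x x' :: real assume "x \<le> x'"
  have "\<phi> \<le> translate (- (x' - x)) \<phi>"
    using monoD[OF \<phi>(2)] \<open>x \<le> x'\<close> by (simp add: le_fun_def translate_def)
  hence "P \<phi> \<le> P (translate (- (x' - x)) \<phi>)"
    by (rule mono_onD[OF P(2) \<phi>(1) translate_C_plus[OF \<phi>(1)]])
  also have "\<dots> \<le> translate (- (x' - x)) (P \<phi>)"
    using P(3)[unfolded A1_def, rule_format, OF \<phi>(1), of "x' - x"] \<open>x \<le> x'\<close> by simp
  finally have "P \<phi> \<theta> x \<le> translate (- (x' - x)) (P \<phi>) \<theta> x" by (simp add: le_fun_def)
  thus "P \<phi> \<theta> x \<le> P \<phi> \<theta> x'" by (simp add: translate_def)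
qed

lemma funpow_preserves_mono:
  fixes P :: "('m::topological_space, 'n::finite) C_fun \<Rightarrow> ('m, 'n) C_fun"
  assumes P: "P \<in> C_plus \<rightarrow> C_plus" "mono_on C_plus P" "A1 P"
    and \<phi>: "\<phi> \<in> C_plus" "\<And>\<theta>. mono (\<phi> \<theta>)"
  shows "mono ((P ^^ n) \<phi> \<theta>)"
proof (induction n arbitrary: \<theta>)
  case (Suc n)
  then show ?case using A1_preserves_mono[OF P funpow_C_plus[OF P(1) \<phi>(1)]] by simp
qed (use \<phi> in simp)

section \<open>Behaviour at the left end\<close>

text \<open>
  Since \<open>r\<close> does not depend on \<open>x\<close>, translating it changes nothing, and the value of
  \<open>P\<^sup>n [r]\<close> at \<open>y\<close> is the value at \<open>0\<close> of the functions that converge to \<open>L\<^sup>n [r]\<close> as \<open>y \<rightarrow> -\<infinity>\<close>.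
\<close>

lemma UAA_tendsto_zero_at_bot:
  fixes P :: "('m::topological_space, 'n::finite) C_fun \<Rightarrow> ('m, 'n) C_fun"
  assumes lim: "\<And>n. limitin C_top (\<lambda>y. translate (-y) ((P ^^ n) (translate y (of_Y r))))
                       ((L ^^ n) (of_Y r)) at_bot"
    and UAA: "UAA L" and r: "of_Y r \<in> C_plus"
    and W: "W \<in> C_plus" "\<And>n. W \<le> (P ^^ n) (of_Y r)"
  shows "uniform_limit UNIV (\<lambda>s \<theta>. W \<theta> s) (\<lambda>\<theta>. 0) at_bot"
  unfolding uniform_limit_iff
proof (intro allI impI)
  fix e :: real assume "e > 0"
  define S where "S = (\<lambda>n. SUP (\<theta>, x)\<in>UNIV. (L ^^ n) (of_Y r) \<theta> x)"
  have "S \<longlonglongrightarrow> 0" using UAA r unfolding UAA_def S_def by blast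
  hence "\<forall>\<^sub>F n in sequentially. norm (S n) < e/2"
    using \<open>e > 0\<close> by (auto simp: tendsto_iff dist_norm dest: spec[of _ "e/2"])
  then obtain n where n: "norm (S n) < e/2" using eventually_happens'[OF sequentially_bot] by blast
  have "(L ^^ n) (of_Y r) \<in> C_space" using limitin_topspace[OF lim[of n]] by simp
  then obtain B where B: "\<And>\<theta> x. norm ((L ^^ n) (of_Y r) \<theta> x) \<le> B" using C_space_bounded by blast
  \<comment> \<open>The supremum is meaningful only for a bounded set; boundedness holds since \<open>L\<^sup>n [r]\<close> is a limit
    in \<open>C\<close>.\<close>
  have LS: "(L ^^ n) (of_Y r) \<theta> x \<le> S n" for \<theta> x
  proof -
    have "v \<le> vec B" if "norm v \<le> B" for v :: "real^'n"
      unfolding less_eq_vec_def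
    proof
      fix i
      show "v $ i \<le> vec B $ i" using that component_le_norm_cart[of v i] by simp
    qed
    hence "bdd_above ((\<lambda>(\<theta>, x). (L ^^ n) (of_Y r) \<theta> x) ` UNIV)"
      using B by (intro bdd_aboveI2[of _ _ "vec B"]) auto
    thus ?thesis unfolding S_def using cSUP_upper[of "(\<theta>, x)" UNIV] by fastforce
  qed
  have "\<forall>\<^sub>F y in at_bot. \<forall>\<theta>. \<forall>x. \<bar>x\<bar> \<le> 0 \<longrightarrow>
      norm (translate (-y) ((P ^^ n) (translate y (of_Y r))) \<theta> x - (L ^^ n) (of_Y r) \<theta> x) < e/2"
    by (rule limitin_C_top_locally_uniform[OF lim[of n] half_gt_zero[OF \<open>e > 0\<close>]])
  thus "\<forall>\<^sub>F y in at_bot. \<forall>\<theta>\<in>UNIV. dist (W \<theta> y) 0 < e"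
  proof (eventually_elim, intro ballI)
    fix y \<theta>
    assume *: "\<forall>\<theta>. \<forall>x. \<bar>x\<bar> \<le> 0 \<longrightarrow>
      norm (translate (-y) ((P ^^ n) (translate y (of_Y r))) \<theta> x - (L ^^ n) (of_Y r) \<theta> x) < e/2"
    let ?d = "(P ^^ n) (of_Y r) \<theta> y - (L ^^ n) (of_Y r) \<theta> 0"
    have "norm ?d < e/2"
      using spec[OF spec[OF *, of \<theta>], of 0] by (simp add: translate_def of_Y_def)
    have "W \<theta> y \<le> (P ^^ n) (of_Y r) \<theta> y" using W(2) by (simp add: le_fun_def)
    also have "\<dots> \<le> ?d + S n" using LS[of \<theta> 0] by (simp add: algebra_simps)
    finally have "norm (W \<theta> y) \<le> norm (?d + S n)"
      by (intro norm_le_norm_nonneg C_plusD(2)[OF W(1)])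
    also have "\<dots> < e" using norm_triangle_ineq[of ?d "S n"] n \<open>norm ?d < e/2\<close> by linarith
    finally show "dist (W \<theta> y) 0 < e" by simp
  qed
qed

section \<open>Behaviour at the right end\<close>

text \<open>
  A point moving with velocity \<open>-x0\<close> strictly between \<open>-c\<^sub>-\<close> and \<open>c\<^sub>+\<close> moves away linearly from both
  ends of the interval of convergence in (UC), so that a window of any fixed radius around it is
  eventually contained in this interval.
\<close>

lemma UC_moving_window:
  assumes UC: "UC L r cm cp" and x0: "- cp < x0" "x0 < cm"
    and \<phi>: "\<phi> \<in> C_plus - {of_vec 0}"
    and L: "\<And>n. (L ^^ n) \<phi> \<in> C_space" and r: "of_Y r \<in> C_space"
    and "e > 0"
  shows "\<forall>\<^sub>F n in sequentially. \<forall>\<theta> x. \<bar>x\<bar> \<le> R \<longrightarrow>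
           norm ((L ^^ n) \<phi> \<theta> (x - real n * x0) - r \<theta>) < e"
proof -
  \<comment> \<open>Half of the smaller velocity gap: the other half leaves room \<open>n \<epsilon>\<close> for the window.\<close>
  define \<epsilon> where "\<epsilon> = min (cm - x0) (cp + x0) / 2"
  have \<epsilon>: "0 < \<epsilon>" "\<epsilon> < (cp + cm) / 2" "2 * \<epsilon> \<le> cm - x0" "2 * \<epsilon> \<le> cp + x0"
    using x0 by (auto simp: \<epsilon>_def min_def)
  let ?I = "\<lambda>n. {real n * (- cm + \<epsilon>)..real n * (cp - \<epsilon>)}"
  let ?N = "\<lambda>n x. norm_Y (\<lambda>\<theta>. (L ^^ n) \<phi> \<theta> x - r \<theta>)"
  have "(\<lambda>n. SUP x\<in>?I n. ?N n x) \<longlonglongrightarrow> 0"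
    using UC \<phi> \<epsilon>(1,2) unfolding UC_def by (auto dest!: bspec[of _ _ \<epsilon>])
  hence small: "\<forall>\<^sub>F n in sequentially. (SUP x\<in>?I n. ?N n x) < e"
    using \<open>e > 0\<close> by (rule order_tendstoD(2))
  obtain n0 where n0: "R / \<epsilon> \<le> real n0" using real_arch_simple by blast
  have large: "\<forall>\<^sub>F n in sequentially. R \<le> real n * \<epsilon>"
    using eventually_ge_at_top[of n0]
  proof eventually_elim
    case (elim n)
    hence "R / \<epsilon> \<le> real n" using n0 by linarith
    thus ?case using \<epsilon>(1) by (simp add: field_simps)
  qed
  show ?thesis using small large
  proof (eventually_elim, intro allI impI)
    fix n \<theta> x
    assume S: "(SUP x\<in>?I n. ?N n x) < e" and n: "R \<le> real n * \<epsilon>" and x: "\<bar>x\<bar> \<le> R"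
    have d: "(\<lambda>\<theta> x. (L ^^ n) \<phi> \<theta> x - of_Y r \<theta> x) \<in> C_space" by (rule C_space_diff[OF L r])
    obtain B where B: "\<And>\<theta> x. norm ((L ^^ n) \<phi> \<theta> x - r \<theta>) \<le> B"
      using C_space_bounded[OF d] by (auto simp: of_Y_def)
    let ?z = "x - real n * x0"
    have "real n * (2 * \<epsilon>) \<le> real n * (cm - x0)" "real n * (2 * \<epsilon>) \<le> real n * (cp + x0)"
      using \<epsilon> by (intro mult_left_mono; simp)+
    hence z: "?z \<in> ?I n" using x n by (auto simp: algebra_simps)
    have "norm ((L ^^ n) \<phi> \<theta> ?z - r \<theta>) \<le> ?N n ?z"
      unfolding norm_Y_def by (intro cSUP_upper bdd_aboveI2[of _ _ B] B) auto
    also have "\<dots> \<le> (SUP x\<in>?I n. ?N n x)"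
      by (intro cSUP_upper z bdd_aboveI2[of _ _ B]) (auto simp: norm_Y_def intro!: cSUP_least B)
    also have "\<dots> < e" by (rule S)
    finally show "norm ((L ^^ n) \<phi> \<theta> ?z - r \<theta>) < e" .
  qed
qed

text \<open>
  The order of the quantifiers matters: (UC) fixes the number of iterations \<open>n\<close> first, and how far
  to the right one must start for \<open>P\<^sup>n\<close> to resemble \<open>L\<^sup>n\<close> depends on \<open>n\<close>.
\<close>

lemma eventually_close_in_window:
  fixes P :: "('m::topological_space, 'n::finite) C_fun \<Rightarrow> ('m, 'n) C_fun"
  assumes lim: "\<And>n. limitin C_top (\<lambda>y. translate (-y) ((P ^^ n) (translate y \<phi>)))
                       ((L ^^ n) \<phi>) at_top"
    and UC: "UC L r cm cp" and x0: "- cp < x0" "x0 < cm"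
    and \<phi>: "\<phi> \<in> C_plus - {of_vec 0}" and r: "of_Y r \<in> C_space"
    and "e > 0"
  shows "\<forall>\<^sub>F n in sequentially. \<forall>\<^sub>F y in at_top. \<forall>\<theta> x. \<bar>x\<bar> \<le> R \<longrightarrow>
           norm ((P ^^ n) (translate y \<phi>) \<theta> (y + x - real n * x0) - r \<theta>) < e"
proof -
  have L: "(L ^^ n) \<phi> \<in> C_space" for n using limitin_topspace[OF lim[of n]] by simp
  have "\<forall>\<^sub>F n in sequentially. \<forall>\<theta> x. \<bar>x\<bar> \<le> R \<longrightarrow>
      norm ((L ^^ n) \<phi> \<theta> (x - real n * x0) - r \<theta>) < e/2"
    by (rule UC_moving_window[OF UC x0 \<phi> L r half_gt_zero[OF \<open>e > 0\<close>]])
  thus ?thesis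
  proof eventually_elim
    case (elim n)
    \<comment> \<open>The radius is enlarged so as to contain the window after its shift by \<open>n x0\<close>.\<close>
    have "\<forall>\<^sub>F y in at_top. \<forall>\<theta> x. \<bar>x\<bar> \<le> R + real n * \<bar>x0\<bar> \<longrightarrow>
        norm (translate (-y) ((P ^^ n) (translate y \<phi>)) \<theta> x - (L ^^ n) \<phi> \<theta> x) < e/2"
      by (rule limitin_C_top_locally_uniform[OF lim[of n] half_gt_zero[OF \<open>e > 0\<close>]])
    thus ?case
    proof (eventually_elim, intro allI impI)
      fix y \<theta> x
      assume *: "\<forall>\<theta> x. \<bar>x\<bar> \<le> R + real n * \<bar>x0\<bar> \<longrightarrow>
        norm (translate (-y) ((P ^^ n) (translate y \<phi>)) \<theta> x - (L ^^ n) \<phi> \<theta> x) < e/2"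
        and x: "\<bar>x\<bar> \<le> R"
      let ?z = "x - real n * x0"
      have "\<bar>?z\<bar> \<le> \<bar>x\<bar> + \<bar>real n * x0\<bar>" by (rule abs_triangle_ineq4)
      hence "\<bar>?z\<bar> \<le> R + real n * \<bar>x0\<bar>" using x by (simp add: abs_mult)
      hence "norm ((P ^^ n) (translate y \<phi>) \<theta> (y + x - real n * x0) - (L ^^ n) \<phi> \<theta> ?z) < e/2"
        using spec[OF spec[OF *, of \<theta>], of ?z] by (simp add: translate_def add.commute add_diff_eq)
      moreover have "norm ((L ^^ n) \<phi> \<theta> ?z - r \<theta>) < e/2" using elim x by simp
      ultimately have
        "norm ((P ^^ n) (translate y \<phi>) \<theta> (y + x - real n * x0) - r \<theta>) < e/2 + e/2"
        by (rule norm_diff_triangle_less)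
      thus "norm ((P ^^ n) (translate y \<phi>) \<theta> (y + x - real n * x0) - r \<theta>) < e" by simp
    qed
  qed
qed

definition tent :: "real \<Rightarrow> ('m, 'n::finite) C_fun" where
  "tent \<delta> = (\<lambda>\<theta> x. vec (\<delta> * max 0 (1 - \<bar>x\<bar>)))"

lemma tent_C_plus:
  assumes "\<delta> > 0"
  shows "(tent \<delta> :: ('m::topological_space, 'n::finite) C_fun) \<in> C_plus - {of_vec 0}"
proof -
  have "continuous_on UNIV (\<lambda>p :: 'm \<times> real. \<chi> i :: 'n. \<delta> * max 0 (1 - \<bar>snd p\<bar>))"
    by (intro continuous_intros)
  moreover have "norm (tent \<delta> \<theta> x :: real^'n) \<le> norm (vec \<delta> :: real^'n)" for \<theta> :: 'm and x
  proof (rule norm_le_norm_nonneg)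
    show "0 \<le> (tent \<delta> \<theta> x :: real^'n)" using assms by (simp add: tent_def less_eq_vec_def)
    show "(tent \<delta> \<theta> x :: real^'n) \<le> vec \<delta>"
      using assms by (auto simp: tent_def less_eq_vec_def max_def)
  qed
  ultimately have "(tent \<delta> :: ('m, 'n) C_fun) \<in> C_space"
    by (intro C_spaceI) (auto simp: tent_def vec_def case_prod_unfold)
  moreover have "tent \<delta> \<theta> 0 \<noteq> (0 :: real^'n)" for \<theta> :: 'm
    using assms by (simp add: tent_def vec_eq_iff)
  hence "tent \<delta> \<noteq> (of_vec 0 :: ('m, 'n) C_fun)" by (auto simp: of_vec_def fun_eq_iff)
  ultimately show ?thesis using assms by (auto simp: C_plus_def tent_def less_eq_vec_def)
qed

text \<open>
  By \<open>eventually_close_in_window\<close>, \<open>P\<^sup>n\<close> lifts the tent centred at \<open>y\<close> to almost \<open>r \<ge> 2\<delta>\<close> near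
  \<open>y - n x0\<close>, hence above a tent of height \<open>\<delta>\<close> there. As the iterates of \<open>r\<close> are nondecreasing in
  \<open>x\<close> and \<open>x0 \<ge> 0\<close>, they are also above the tent centred at \<open>y\<close>, and the step can be repeated
  without any loss of position. The threshold \<open>y1\<close> is the same for all \<open>k\<close>.
\<close>

lemma tent_barrier:
  fixes P :: "('m::topological_space, 'n::finite) C_fun \<Rightarrow> ('m, 'n) C_fun"
  assumes P: "P \<in> C_plus \<rightarrow> C_plus" "mono_on C_plus P" "A1 P"
    and lim: "\<And>n. limitin C_top (\<lambda>y. translate (-y) ((P ^^ n) (translate y (tent \<delta>))))
                       ((L ^^ n) (tent \<delta>)) at_top"
    and UC: "UC L r cm cp" and x0: "- cp < x0" "x0 < cm" "0 \<le> x0"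
    and \<delta>: "\<delta> > 0" "\<And>\<theta> i. 2 * \<delta> \<le> r \<theta> $ i" and r: "of_Y r \<in> C_plus"
  shows "\<exists>n>0. \<exists>y1. \<forall>k. \<forall>y\<ge>y1. translate y (tent \<delta>) \<le> (P ^^ (k * n)) (of_Y r)"
proof -
  have "\<forall>\<^sub>F n in sequentially. (\<forall>\<^sub>F y in at_top. \<forall>\<theta> x. \<bar>x\<bar> \<le> 1 \<longrightarrow>
      norm ((P ^^ n) (translate y (tent \<delta>)) \<theta> (y + x - real n * x0) - r \<theta>) < \<delta>) \<and> n > 0"
    by (intro eventually_conj eventually_gt_at_top
        eventually_close_in_window[OF lim UC x0(1,2) tent_C_plus[OF \<delta>(1)] C_plusD(1)[OF r] \<delta>(1)])
  then obtain n where "n > 0" and n: "\<forall>\<^sub>F y in at_top. \<forall>\<theta> x. \<bar>x\<bar> \<le> 1 \<longrightarrow>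
      norm ((P ^^ n) (translate y (tent \<delta>)) \<theta> (y + x - real n * x0) - r \<theta>) < \<delta>"
    using eventually_happens'[OF sequentially_bot] by blast
  then obtain y1 where y1: "\<And>y \<theta> x. y \<ge> y1 \<Longrightarrow> \<bar>x\<bar> \<le> 1 \<Longrightarrow>
      norm ((P ^^ n) (translate y (tent \<delta>)) \<theta> (y + x - real n * x0) - r \<theta>) < \<delta>"
    unfolding eventually_at_top_linorder by blast
  have tent: "translate y (tent \<delta>) \<in> C_plus" for y
    using translate_C_plus tent_C_plus[OF \<delta>(1)] by blast
  \<comment> \<open>Inside the support the estimate \<open>r - \<delta> \<ge> \<delta>\<close> is used; outside, positivity of the iterates.\<close>
  have step: "tent \<delta> \<theta> x \<le> (P ^^ n) (translate y (tent \<delta>)) \<theta> (y + x - real n * x0)"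
    if "y \<ge> y1" for y \<theta> x
  proof (cases "\<bar>x\<bar> \<le> 1")
    case True
    let ?v = "(P ^^ n) (translate y (tent \<delta>)) \<theta> (y + x - real n * x0)"
    show ?thesis unfolding less_eq_vec_def
    proof
      fix i
      have "\<bar>?v $ i - r \<theta> $ i\<bar> < \<delta>"
        using y1[OF that True, of \<theta>] component_le_norm_cart[of "?v - r \<theta>" i] by simp
      moreover have "\<delta> * max 0 (1 - \<bar>x\<bar>) \<le> \<delta> * 1" using \<delta>(1) by (intro mult_left_mono) auto
      ultimately show "tent \<delta> \<theta> x $ i \<le> ?v $ i" using \<delta>(2)[of \<theta> i] by (simp add: tent_def)
    qed
  next
    case False
    hence "(tent \<delta> :: ('m, 'n) C_fun) \<theta> x = 0" by (simp add: tent_def vec_eq_iff)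
    thus ?thesis using C_plusD(2)[OF funpow_C_plus[OF P(1) tent]] by metis
  qed
  have "translate y (tent \<delta>) \<le> (P ^^ (k * n)) (of_Y r)" if "y \<ge> y1" for y k
  proof (induction k)
    case 0
    have "tent \<delta> \<theta> x \<le> r \<theta>" for \<theta> x unfolding less_eq_vec_def
    proof
      fix i
      have "\<delta> * max 0 (1 - \<bar>x\<bar>) \<le> \<delta> * 1" using \<delta>(1) by (intro mult_left_mono) auto
      also have "\<dots> \<le> r \<theta> $ i" using \<delta>(1) \<delta>(2)[of \<theta> i] by simp
      finally show "tent \<delta> \<theta> x $ i \<le> r \<theta> $ i" by (simp add: tent_def)
    qed
    thus ?case by (simp add: le_fun_def translate_def of_Y_def)
  next
    case (Suc k)
    let ?u = "(P ^^ (k * n)) (of_Y r)"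
    have le: "(P ^^ n) (translate y (tent \<delta>)) \<le> (P ^^ n) ?u"
      by (rule mono_onD[OF funpow_mono_on_C_plus[OF P(1,2)] tent funpow_C_plus[OF P(1) r] Suc])
    show ?case
    proof (intro le_funI)
      fix \<theta> x
      have "translate y (tent \<delta>) \<theta> x
          \<le> (P ^^ n) (translate y (tent \<delta>)) \<theta> (x - real n * x0)"
        using step[OF that, of \<theta> "x - y"] by (simp add: translate_def)
      also have "\<dots> \<le> (P ^^ n) ?u \<theta> (x - real n * x0)" using le by (simp add: le_fun_def)
      also have "\<dots> = (P ^^ (Suc k * n)) (of_Y r) \<theta> (x - real n * x0)"
        by (simp add: funpow_add)
      also have "\<dots> \<le> (P ^^ (Suc k * n)) (of_Y r) \<theta> x"
        by (rule monoD[OF funpow_preserves_mono[OF P r]])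
           (use x0(3) in \<open>auto simp: of_Y_def mono_def\<close>)
      finally show "translate y (tent \<delta>) \<theta> x \<le> (P ^^ (Suc k * n)) (of_Y r) \<theta> x" .
    qed
  qed
  thus ?thesis using \<open>n > 0\<close> by blast
qed

text \<open>
  Any nonzero \<open>\<phi>\<close> all of whose far translates lie below the fixed point \<open>W\<close> suffices: applying
  \<open>P\<^sup>n\<close> to \<open>T\<^sub>y [\<phi>] \<le> W\<close> leaves the right side unchanged and brings the left side within \<open>e\<close> of
  \<open>r\<close> at \<open>y - n x0\<close>, with \<open>n\<close> fixed and \<open>y\<close> arbitrarily large.
\<close>

lemma UC_tendsto_at_top:
  fixes P :: "('m::topological_space, 'n::finite) C_fun \<Rightarrow> ('m, 'n) C_fun"
  assumes P: "P \<in> C_plus \<rightarrow> C_plus" "mono_on C_plus P"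
    and lim: "\<And>n. limitin C_top (\<lambda>y. translate (-y) ((P ^^ n) (translate y \<phi>)))
                       ((L ^^ n) \<phi>) at_top"
    and UC: "UC L r cm cp" and \<phi>: "\<phi> \<in> C_plus - {of_vec 0}" and r: "of_Y r \<in> C_space"
    and W: "W \<in> C_plus" "P W = W" "W \<le> of_Y r"
    and barrier: "\<And>y. y \<ge> y1 \<Longrightarrow> translate y \<phi> \<le> W"
  shows "uniform_limit UNIV (\<lambda>s \<theta>. W \<theta> s) r at_top"
  unfolding uniform_limit_iff
proof (intro allI impI)
  fix e :: real assume "e > 0"
  \<comment> \<open>With \<open>n\<close> fixed the shift \<open>n x0\<close> is bounded, so any speed in \<open>(-cp, cm)\<close>, of either sign, would do.\<close>
  define x0 where "x0 = (cm - cp) / 2"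
  have x0: "- cp < x0" "x0 < cm" using UC by (auto simp: UC_def x0_def field_simps)
  obtain n where n: "\<forall>\<^sub>F y in at_top. \<forall>\<theta> x. \<bar>x\<bar> \<le> 0 \<longrightarrow>
      norm ((P ^^ n) (translate y \<phi>) \<theta> (y + x - real n * x0) - r \<theta>) < e"
    using eventually_happens'[OF sequentially_bot
        eventually_close_in_window[OF lim UC x0 \<phi> r \<open>e > 0\<close>]] by blast
  have "\<forall>\<^sub>F y in at_top. \<forall>\<theta>\<in>UNIV. dist (W \<theta> (y - real n * x0)) (r \<theta>) < e"
    using n eventually_ge_at_top[of y1]
  proof (eventually_elim, intro ballI)
    fix y \<theta>
    assume *: "\<forall>\<theta> x. \<bar>x\<bar> \<le> 0 \<longrightarrow>
      norm ((P ^^ n) (translate y \<phi>) \<theta> (y + x - real n * x0) - r \<theta>) < e" and "y1 \<le> y"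
    let ?z = "y - real n * x0"
    let ?v = "(P ^^ n) (translate y \<phi>) \<theta> ?z"
    have "(P ^^ n) W = W" by (induction n) (auto simp: W(2))
    hence "(P ^^ n) (translate y \<phi>) \<le> W"
      using mono_onD[OF funpow_mono_on_C_plus[OF P, of n] _ W(1) barrier[OF \<open>y1 \<le> y\<close>]]
        translate_C_plus[of \<phi> y] \<phi> by simp
    hence "?v \<le> W \<theta> ?z" by (simp add: le_fun_def)
    moreover have "W \<theta> ?z \<le> r \<theta>" using W(3) by (simp add: le_fun_def of_Y_def)
    ultimately have "norm (r \<theta> - W \<theta> ?z) \<le> norm (r \<theta> - ?v)"
      by (intro norm_le_norm_nonneg) (auto simp: algebra_simps)
    also have "\<dots> < e" using spec[OF spec[OF *, of \<theta>], of 0] by (simp add: norm_minus_commute)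
    finally show "dist (W \<theta> ?z) (r \<theta>) < e" by (simp add: dist_norm norm_minus_commute)
  qed
  then obtain Y where Y: "\<And>y. y \<ge> Y \<Longrightarrow> \<forall>\<theta>\<in>UNIV. dist (W \<theta> (y - real n * x0)) (r \<theta>) < e"
    unfolding eventually_at_top_linorder by blast
  show "\<forall>\<^sub>F s in at_top. \<forall>\<theta>\<in>UNIV. dist (W \<theta> s) (r \<theta>) < e"
    unfolding eventually_at_top_linorder
  proof (intro exI allI impI)
    fix s assume "Y - real n * x0 \<le> s"
    thus "\<forall>\<theta>\<in>UNIV. dist (W \<theta> s) (r \<theta>) < e" using Y[of "s + real n * x0"] by simp
  qed
qed

section \<open>The equilibrium\<close>

lemma Int_Y_plus_in_C_plus:
  assumes M: "compact (UNIV :: 'm::topological_space set)" and r: "r \<in> Int_Y_plus"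
  shows "(of_Y r :: ('m, 'n::finite) C_fun) \<in> C_plus"
proof -
  have c: "continuous_on UNIV r" using r by (simp add: Int_Y_plus_def)
  obtain B where B: "\<And>\<theta>. norm (r \<theta>) \<le> B"
    using compact_imp_bounded[OF compact_continuous_image[OF c M]] by (auto simp: bounded_iff)
  have "continuous_on UNIV (\<lambda>p :: 'm \<times> real. r (fst p))"
    by (rule continuous_on_compose2[OF c]) (auto intro: continuous_intros)
  hence "of_Y r \<in> C_space"
    by (intro C_spaceI[of _ B]) (auto simp: of_Y_def case_prod_unfold B)
  thus ?thesis using r
    by (auto simp: C_plus_def of_Y_def Int_Y_plus_def Int_RN_plus_iff less_eq_vec_def less_imp_le)
qed

lemma Int_Y_plus_lower_bound:
  assumes M: "compact (UNIV :: 'm::topological_space set)" and r: "(r :: 'm \<Rightarrow> real^'n) \<in> Int_Y_plus"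
  obtains \<delta> where "\<delta> > 0" "\<And>\<theta> i. \<delta> \<le> r \<theta> $ i"
proof -
  have "\<exists>d>0. \<forall>\<theta>. d \<le> r \<theta> $ i" for i
  proof -
    have "continuous_on UNIV (\<lambda>\<theta>. r \<theta> $ i)" using r by (auto simp: Int_Y_plus_def intro: continuous_intros)
    then obtain \<theta>0 where "\<forall>\<theta>. r \<theta>0 $ i \<le> r \<theta> $ i"
      using continuous_attains_inf[OF M] by blast
    moreover have "r \<theta>0 $ i > 0" using r by (simp add: Int_Y_plus_def Int_RN_plus_iff)
    ultimately show ?thesis by blast
  qed
  then obtain d where d: "\<And>i. d i > 0" "\<And>i \<theta>. d i \<le> r \<theta> $ i" by metis
  show ?thesis
  proof
    show "Min (range d) > 0" using d(1) by simp
    show "Min (range d) \<le> r \<theta> $ i" for \<theta> i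
      by (rule order_trans[OF Min_le d(2)[of i]]) auto
  qed
qed

text \<open>
  Continuity of \<open>Q\<^sub>t\<close> turns \<open>Q\<^sup>n [r] \<rightarrow> W\<close> (along a subsequence) into \<open>Q\<^sub>t Q\<^sup>n [r] \<rightarrow> Q\<^sub>t [W]\<close>. On the other
  hand \<open>W \<le> Q\<^sup>n\<^sup>+\<^sup>m [r] \<le> Q\<^sub>t Q\<^sup>n [r] \<le> Q\<^sup>n [r]\<close> as soon as \<open>m t0 \<ge> t\<close>, so the limit is \<open>W\<close>.
\<close>

lemma semiflow_decreasing_limit_equilibrium:
  assumes Q: "semiflow Q" and A2: "\<And>t. t \<ge> 0 \<Longrightarrow> A2 (Q t)" and "t0 > 0"
    and r: "r \<in> C_plus" and dec: "\<And>t. t \<ge> 0 \<Longrightarrow> Q t r \<le> r"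
    and pre: "precompact_C (range (\<lambda>n. (Q t0 ^^ n) r))"
  obtains W where "equilibrium Q W" "decseq (\<lambda>n. (Q t0 ^^ n) r)"
    "\<And>\<theta> x. (\<lambda>n. (Q t0 ^^ n) r \<theta> x) \<longlonglongrightarrow> W \<theta> x" "\<And>n. W \<le> (Q t0 ^^ n) r"
proof -
  define \<sigma> where "\<sigma> = (\<lambda>n. (Q t0 ^^ n) r)"
  have maps: "Q t \<phi> \<in> C_plus" if "t \<ge> 0" "\<phi> \<in> C_plus" for t \<phi>
    using Q that unfolding semiflow_def by blast
  have add: "Q t (Q s \<phi>) = Q (t + s) \<phi>" if "t \<ge> 0" "s \<ge> 0" "\<phi> \<in> C_plus" for t s \<phi>
    using Q that unfolding semiflow_def by blast
  have \<sigma>_eq: "\<sigma> n = Q (real n * t0) r" for n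
  proof (induction n)
    case 0 show ?case using Q r by (simp add: \<sigma>_def semiflow_def)
  next
    case (Suc n)
    have "\<sigma> (Suc n) = Q t0 (\<sigma> n)" by (simp add: \<sigma>_def)
    also have "\<dots> = Q (real (Suc n) * t0) r"
      using Suc add[of t0 "real n * t0" r] \<open>t0 > 0\<close> r by (simp add: algebra_simps)
    finally show ?case .
  qed
  have anti: "Q t r \<le> Q s r" if "0 \<le> s" "s \<le> t" for s t
  proof -
    have "Q s (Q (t - s) r) \<le> Q s r"
      by (rule mono_onD[OF A2_mono_on[OF A2[OF \<open>0 \<le> s\<close>]] maps r dec]) (use that r in auto)
    moreover have "Q s (Q (t - s) r) = Q t r" using add[of s "t - s" r] that r by simp
    ultimately show ?thesis by simp
  qed
  have D: "decseq \<sigma>"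
    unfolding decseq_def \<sigma>_eq using \<open>t0 > 0\<close>
    by (intro allI impI anti) (simp_all add: mult_right_mono)
  obtain W s where s: "strict_mono s" and lim: "limitin C_top (\<sigma> \<circ> s) W sequentially"
    and W: "\<And>\<theta> x. (\<lambda>n. \<sigma> n \<theta> x) \<longlonglongrightarrow> W \<theta> x"
    by (rule decseq_precompact_converges[OF D pre[folded \<sigma>_def]]) (rule that)
  have \<sigma>C: "\<sigma> n \<in> C_plus" for n unfolding \<sigma>_eq using maps r \<open>t0 > 0\<close> by simp
  have Wc: "(\<lambda>n. \<sigma> n \<theta> x $ i) \<longlonglongrightarrow> W \<theta> x $ i" for \<theta> x i
    by (rule tendsto_vec_nth[OF W])
  have W_le: "W \<le> \<sigma> n" for n
  proof (intro le_funI)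
    fix \<theta> x
    have "W \<theta> x $ i \<le> \<sigma> n \<theta> x $ i" for i
      by (rule decseq_ge[OF _ Wc]) 
         (use decseqD[OF D] in \<open>simp add: decseq_def le_fun_def less_eq_vec_def\<close>)
    thus "W \<theta> x \<le> \<sigma> n \<theta> x" by (simp add: less_eq_vec_def)
  qed
  have WC: "W \<in> C_plus"
  proof -
    have "0 \<le> W \<theta> x $ i" for \<theta> x i
      by (rule LIMSEQ_le_const[OF Wc]) (use C_plusD(2)[OF \<sigma>C] in \<open>auto simp: less_eq_vec_def\<close>)
    thus ?thesis using limitin_topspace[OF lim] by (simp add: C_plus_def less_eq_vec_def)
  qed
  have \<sigma>_le: "\<sigma> n \<le> r" for n unfolding \<sigma>_eq using dec \<open>t0 > 0\<close> by simp
  have "Q t W = W" if "t \<ge> 0" for t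
  proof -
    have "limitin C_top (\<lambda>k. Q t ((\<sigma> \<circ> s) k)) (Q t W) sequentially"
      by (rule A2_limitin[OF A2[OF that] _ _ r WC _ lim])
         (use \<sigma>C \<sigma>_le order_trans[OF W_le[of 0] \<sigma>_le[of 0]] in auto)
    note lim_t = limitin_C_top_pointwise[OF this]
    obtain m where m: "t / t0 \<le> real m" using real_arch_simple by blast
    hence m: "t \<le> real m * t0" using \<open>t0 > 0\<close> by (simp add: field_simps)
    have Q\<sigma>: "Q t (\<sigma> n) = Q (t + real n * t0) r" for n
      unfolding \<sigma>_eq using add that \<open>t0 > 0\<close> r by simp
    have up: "Q t (\<sigma> n) \<le> \<sigma> n" for n
      unfolding Q\<sigma> unfolding \<sigma>_eq by (rule anti) (use that \<open>t0 > 0\<close> in auto)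
    have low: "W \<le> Q t (\<sigma> n)" for n
    proof -
      have "W \<le> \<sigma> (n + m)" by (rule W_le)
      also have "\<dots> \<le> Q t (\<sigma> n)"
        unfolding Q\<sigma> unfolding \<sigma>_eq
        by (rule anti) (use that \<open>t0 > 0\<close> m in \<open>auto simp: algebra_simps\<close>)
      finally show ?thesis .
    qed
    show ?thesis
    proof (intro ext)
      fix \<theta> x
      have "(\<lambda>k. Q t (\<sigma> (s k)) \<theta> x $ i) \<longlonglongrightarrow> W \<theta> x $ i" for i
      proof (rule tendsto_sandwich[OF _ _ tendsto_const])
        show "\<forall>\<^sub>F k in sequentially. W \<theta> x $ i \<le> Q t (\<sigma> (s k)) \<theta> x $ i"
          using low by (auto simp: le_fun_def less_eq_vec_def)
        show "\<forall>\<^sub>F k in sequentially. Q t (\<sigma> (s k)) \<theta> x $ i \<le> \<sigma> (s k) \<theta> x $ i"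
          using up by (auto simp: le_fun_def less_eq_vec_def)
        show "(\<lambda>k. \<sigma> (s k) \<theta> x $ i) \<longlonglongrightarrow> W \<theta> x $ i"
          using LIMSEQ_subseq_LIMSEQ[OF Wc s] by (simp add: o_def)
      qed
      hence "(\<lambda>k. Q t (\<sigma> (s k)) \<theta> x) \<longlonglongrightarrow> W \<theta> x" by (rule vec_tendstoI)
      with lim_t[of \<theta> x, unfolded o_def] show "Q t W \<theta> x = W \<theta> x" by (rule LIMSEQ_unique)
    qed
  qed
  hence "equilibrium Q W" using WC by (simp add: equilibrium_def)
  thus ?thesis by (rule that) (use D W W_le in \<open>simp_all only: \<sigma>_def\<close>)
qed

theorem theorem4p2:
  fixes Q :: "real \<Rightarrow> ('m::topological_space, 'n::finite) C_fun \<Rightarrow> ('m, 'n) C_fun"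
    and t0 :: real and rstar :: "'m \<Rightarrow> real^'n" and cminus cplus :: real
  assumes M_compact: "compact (UNIV :: 'm set)"
    and semiflow: "semiflow Q"
    and A1: "\<And>t. t \<ge> 0 \<Longrightarrow> A1 (Q t)"
    and A2: "\<And>t. t \<ge> 0 \<Longrightarrow> A2 (Q t)"
    and t0: "t0 > 0"
    and A3: "A3 (Q t0)"
    and A4: "A4 (Q t0) rstar"
    and UAA: "UAA (Q_lim_minus (Q t0))"
    and UC: "UC (Q_lim_plus (Q t0)) rstar cminus cplus"
    and SP_or_ASH:
      "(subhomogeneous (Q t0) rstar \<and> SP (Q t0)) \<or>
       (\<exists>cml cpl. ASH_UC_SP (Q t0) rstar cml cpl \<and> cml \<longlonglongrightarrow> cminus \<and> cpl \<longlonglongrightarrow> cplus)"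
    and precompact: "precompact_C {(Q t0 ^^ n) (of_Y rstar) | n. True}"
    and precompact_shifted:
      "cplus \<le> 0 \<Longrightarrow>
        \<exists>x0\<in>{- cplus<..<cminus}. precompact_C {((translate x0 \<circ> Q t0) ^^ n) (of_Y rstar) | n. True}"
    and cminus_pos: "cminus > 0"
    and decreasing: "\<And>t. t \<ge> 0 \<Longrightarrow> Q t (of_Y rstar) \<le> of_Y rstar"
  shows "\<exists>W. equilibrium Q W \<and> connects_zero_to W rstar"
proof -
  let ?P = "Q t0"
  have rI: "rstar \<in> Int_Y_plus" using A4 by (simp add: A4_def)
  have r: "of_Y rstar \<in> C_plus" by (rule Int_Y_plus_in_C_plus[OF M_compact rI])
  have P: "?P \<in> C_plus \<rightarrow> C_plus" using semiflow t0 by (simp add: semiflow_def)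
  have P_mono: "mono_on C_plus ?P" by (rule A2_mono_on[OF A2]) (use t0 in simp)
  have P_A1: "A1 ?P" using A1 t0 by simp
  have pre: "precompact_C (range (\<lambda>n. (?P ^^ n) (of_Y rstar)))"
    using precompact by (simp add: full_SetCompr_eq)
  obtain W where W: "equilibrium Q W" and dec: "decseq (\<lambda>n. (?P ^^ n) (of_Y rstar))"
    and Wlim: "\<And>\<theta> x. (\<lambda>n. (?P ^^ n) (of_Y rstar) \<theta> x) \<longlonglongrightarrow> W \<theta> x"
    and W_le: "\<And>n. W \<le> (?P ^^ n) (of_Y rstar)"
    by (rule semiflow_decreasing_limit_equilibrium[OF semiflow A2 t0 r decreasing pre])
      (assumption+, rule that)
  have WC: "W \<in> C_plus" and W_fix: "?P W = W" using W t0 by (auto simp: equilibrium_def)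

  have left: "uniform_limit UNIV (\<lambda>s \<theta>. W \<theta> s) (\<lambda>\<theta>. 0) at_bot"
    by (rule UAA_tendsto_zero_at_bot[OF _ UAA r WC W_le]) (use A3 r in \<open>auto simp: A3_def\<close>)

  obtain d where d: "d > 0" "\<And>\<theta> i. d \<le> rstar \<theta> $ i"
    using Int_Y_plus_lower_bound[OF M_compact rI] by blast
  define \<phi> :: "('m, 'n) C_fun" where "\<phi> = tent (d/2)"
  have \<phi>: "\<phi> \<in> C_plus - {of_vec 0}" unfolding \<phi>_def by (rule tent_C_plus) (use d in simp)
  have lim: "limitin C_top (\<lambda>y. translate (-y) ((?P ^^ n) (translate y \<phi>)))
      ((Q_lim_plus ?P ^^ n) \<phi>) at_top" for n
    using A3 \<phi> by (simp add: A3_def)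
  \<comment> \<open>Midpoint of \<open>[max 0 (-cplus), cminus]\<close>. This interval is nondegenerate since \<open>cminus > 0\<close> and
    \<open>cplus + cminus > 0\<close>.\<close>
  define x0 where "x0 = (max 0 (- cplus) + cminus) / 2"
  have x0: "- cplus < x0" "x0 < cminus" "0 \<le> x0"
    using UC cminus_pos by (auto simp: x0_def UC_def max_def field_simps)
  have "2 * (d/2) \<le> rstar \<theta> $ i" for \<theta> i using d(2) by simp
  then obtain n y1 where "n > 0"
    and barrier: "\<And>k y. y \<ge> y1 \<Longrightarrow> translate y \<phi> \<le> (?P ^^ (k * n)) (of_Y rstar)"
    using tent_barrier[OF P P_mono P_A1 lim[unfolded \<phi>_def] UC x0 half_gt_zero[OF d(1)] _ r]
    unfolding \<phi>_def by blast
  \<comment> \<open>The barrier is only known for multiples of \<open>n\<close>; since the sequence decreases this is enough.\<close>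
  have "translate y \<phi> \<le> W" if "y \<ge> y1" for y
  proof (intro le_funI)
    fix \<theta> x
    have "translate y \<phi> \<theta> x $ i \<le> W \<theta> x $ i" for i
    proof (rule LIMSEQ_le_const[OF tendsto_vec_nth[OF Wlim]], intro exI allI impI)
      fix k :: nat assume "0 \<le> k"
      have "translate y \<phi> \<le> (?P ^^ (k * n)) (of_Y rstar)" by (rule barrier[OF that])
      also have "\<dots> \<le> (?P ^^ k) (of_Y rstar)"
        by (rule decseqD[OF dec]) (use \<open>n > 0\<close> in simp)
      finally show "translate y \<phi> \<theta> x $ i \<le> (?P ^^ k) (of_Y rstar) \<theta> x $ i"
        by (simp add: le_fun_def less_eq_vec_def)
    qed
    thus "translate y \<phi> \<theta> x \<le> W \<theta> x" by (simp add: less_eq_vec_def)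
  qed
  hence "uniform_limit UNIV (\<lambda>s \<theta>. W \<theta> s) rstar at_top"
    by (intro UC_tendsto_at_top[OF P P_mono lim UC \<phi> C_plusD(1)[OF r] WC W_fix])
       (use W_le[of 0] in auto)
  thus ?thesis using W left by (auto simp: connects_zero_to_def)
qed

end
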